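(* Let $t_0<\tau_0\le+\infty$ and let $a,b,c,d$ and $a_k,b_k,c_k,d_k$ ($k=1,2$) be real-valued continuous functions on $[t_0,\tau_0)$. For $k=1,2$ let $y_k(t)$ be a solution on $[t_0,\tau_0)$ of $$y'+a_k(t)y^3+b_k(t)y^2+c_k(t)y+d_k(t)=0,$$ such that $y_1(t_0)\le y_2(t_0)$. Assume that for all $t\in[t_0,\tau_0)$ $$(a_1(t)-a(t))y_1^3(t)+(b_1(t)-b(t))y_1^2(t)+(c_1(t)-c(t))y_1(t)+d_1(t)-d(t)\ge0$$ and $$(a_2(t)-a(t))y_2^3(t)+(b_2(t)-b(t))y_2^2(t)+(c_2(t)-c(t))y_2(t)+d_2(t)-d(t)\le0.$$ Then every solution $y(t)$ of $$y'+a(t)y^3+b(t)y^2+c(t)y+d(t)=0$$ with $y(t_0)\in[y_1(t_0),y_2(t_0)]$ exists on $[t_0,\tau_0)$ and $$y_1(t)\le y(t)\le y_2(t),\qquad t\in[t_0,\tau_0).$$ Furthermore, if $y_1(t_0)<y(t_0)$, then $y_1(t)<y(t)$ for all $t\in[t_0,\tau_0)$; and if $y(t_0)<y_2(t_0)$, then $y(t)<y_2(t)$ for all $t\in[t_0,\tau_0)$.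
   Context: All functions are real-valued. A solution of a differential equation on an interval is a differentiable function satisfying it at every point of the interval (one-sided derivative at an included endpoint). "A solution $y$ of the equation exists on $[t_0,\tau_0)$" means that the solution of the initial value problem with the given value at $t_0$ is defined on all of $[t_0,\tau_0)$. *)

theory Defs
  imports "HOL-Analysis.Analysis"
begin

definition halfopen :: "real \<Rightarrow> ereal \<Rightarrow> real set" where
  "halfopen t0 \<tau>0 = {t. t0 \<le> t \<and> ereal t < \<tau>0}"

text \<open>The derivative is taken within \<open>I\<close>: it is two-sided at interior points and one-sided at
  an endpoint belonging to \<open>I\<close>.\<close>

definition abel_solution ::
  "(real \<Rightarrow> real) \<Rightarrow> (real \<Rightarrow> real) \<Rightarrow> (real \<Rightarrow> real) \<Rightarrow> (real \<Rightarrow> real) \<Rightarrow>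
    real set \<Rightarrow> (real \<Rightarrow> real) \<Rightarrow> bool" where
  "abel_solution a b c d I y \<longleftrightarrow>
    (\<forall>t\<in>I. \<exists>y'. (y has_real_derivative y') (at t within I) \<and>
       y' + a t * y t ^ 3 + b t * y t ^ 2 + c t * y t + d t = 0)"

text \<open>The solution of the initial value problem is defined on all of \<open>I\<close>: there is a solution on
  \<open>I\<close>, and each solution on a subinterval of \<open>I\<close> containing \<open>t0\<close>, with the same value
  at \<open>t0\<close>, is a restriction of it. Hence no solution stops existing before the end of
  \<open>I\<close>.\<close>

definition abel_ivp_exists_on ::
  "(real \<Rightarrow> real) \<Rightarrow> (real \<Rightarrow> real) \<Rightarrow> (real \<Rightarrow> real) \<Rightarrow> (real \<Rightarrow> real) \<Rightarrow>
    real \<Rightarrow> real \<Rightarrow> real set \<Rightarrow> bool" where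
  "abel_ivp_exists_on a b c d t0 y0 I \<longleftrightarrow>
    (\<exists>y. abel_solution a b c d I y \<and> y t0 = y0 \<and>
      (\<forall>J z. is_interval J \<and> t0 \<in> J \<and> J \<subseteq> I \<and> abel_solution a b c d J z \<and> z t0 = y0
         \<longrightarrow> (\<forall>t\<in>J. z t = y t)))"

end

theory Submission imports Defs begin

text \<open>The hypotheses make \<open>y1\<close> a subsolution and \<open>y2\<close> a supersolution of the Abel equation with
  coefficients \<open>a, b, c, d\<close>. The difference \<open>u\<close> of a super- and a subsolution satisfies
  \<open>u' + g u \<ge> 0\<close> with a continuous \<open>g\<close>, because the cubic right-hand side has a polynomial
  difference quotient. An integrating factor then gives \<open>u t \<ge> k * u t0\<close> with \<open>k > 0\<close>
  (\<open>abel_comparison\<close>). A solution is at once a sub- and a supersolution, so this single estimate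
  contains the order \<open>y1 \<le> y2\<close>, both comparisons of \<open>y\<close> with \<open>y1\<close> and \<open>y2\<close>, their strict versions,
  and uniqueness for the initial value problem.

  Existence up to the end of the interval is the remaining point, since solutions of a cubic
  equation may blow up. The strip between \<open>y1\<close> and \<open>y2\<close> prevents it. Evaluating the right-hand
  side at the point of the strip nearest to the unknown makes it Lipschitz, uniformly on every
  compact interval \<open>{t0..T}\<close>, so Picard iteration solves the modified equation on all of
  \<open>{t0..T}\<close> (\<open>lipschitz_ivp_solution_exists\<close>). The solution stays in the strip
  (\<open>abel_solution_exists_between\<close>), where the two equations coincide. By uniqueness the
  solutions for different \<open>T\<close> fit together (\<open>abel_ivp_exists_on_halfopen\<close>).\<close>

section \<open>Differential inequalities\<close>

lemma nondecreasing_if_deriv_within_nonneg: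
  fixes f :: "real \<Rightarrow> real"
  assumes "s \<le> T" "t0 \<le> s" "continuous_on {t0..T} f"
    and deriv: "\<And>t. s < t \<Longrightarrow> t < T \<Longrightarrow> \<exists>D\<ge>0. (f has_real_derivative D) (at t within {t0..T})"
  shows "f s \<le> f T"
proof (rule DERIV_nonneg_imp_increasing_open[OF \<open>s \<le> T\<close>])
  fix t assume t: "s < t" "t < T"
  then have "at t within {t0..T} = at t"
    using \<open>t0 \<le> s\<close> by (intro at_within_Icc_at) auto
  then show "\<exists>D. (f has_real_derivative D) (at t) \<and> 0 \<le> D"
    using deriv[OF t] by auto
next
  show "continuous_on {s..T} f"
    by (rule continuous_on_subset[OF assms(3)]) (use \<open>t0 \<le> s\<close> in auto)
qed

text \<open>The integrating factor \<open>exp (\<integral> g)\<close> turns \<open>u' + g u \<ge> 0\<close> into monotonicity of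
  \<open>u exp (\<integral> g)\<close>.\<close>

lemma linear_differential_inequality:
  fixes u g :: "real \<Rightarrow> real"
  assumes "t0 \<le> T" and g: "continuous_on {t0..T} g"
    and u: "\<And>t. t \<in> {t0..T} \<Longrightarrow>
      \<exists>D. (u has_real_derivative D) (at t within {t0..T}) \<and> D + g t * u t \<ge> 0"
  shows "u T \<ge> exp (- integral {t0..T} g) * u t0"
proof -
  define G where "G t = integral {t0..t} g" for t
  define w where "w t = u t * exp (G t)" for t
  have w: "\<exists>D\<ge>0. (w has_real_derivative D) (at t within {t0..T})" if t: "t \<in> {t0..T}" for t
  proof -
    obtain D where D: "(u has_real_derivative D) (at t within {t0..T})" "D + g t * u t \<ge> 0"
      using u[OF t] by blast
    have "(G has_real_derivative g t) (at t within {t0..T})"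
      unfolding G_def by (rule integral_has_real_derivative[OF g t])
    then have "(w has_real_derivative D * exp (G t) + exp (G t) * g t * u t) (at t within {t0..T})"
      unfolding w_def using D(1) by (auto intro!: derivative_eq_intros)
    moreover have "D * exp (G t) + exp (G t) * g t * u t = exp (G t) * (D + g t * u t)"
      by (simp add: algebra_simps)
    ultimately show ?thesis
      using D(2) by (metis exp_ge_zero mult_nonneg_nonneg)
  qed
  have "continuous_on {t0..T} w"
    by (rule DERIV_continuous_on[of _ _ "\<lambda>t. SOME D. (w has_real_derivative D) (at t within {t0..T})"])
      (meson someI_ex w)
  then have "w t0 \<le> w T"
    using w by (intro nondecreasing_if_deriv_within_nonneg[OF \<open>t0 \<le> T\<close> order_refl]) auto
  then have "u t0 \<le> u T * exp (G T)"
    by (simp add: w_def G_def)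
  then have "exp (- G T) * u t0 \<le> exp (- G T) * (u T * exp (G T))"
    by (intro mult_left_mono) auto
  also have "\<dots> = u T"
    by (simp add: exp_minus field_simps)
  finally show ?thesis
    by (simp add: G_def)
qed

text \<open>If \<open>f\<close> were negative at \<open>T\<close>, it would be nondecreasing from its last nonnegative value on.\<close>

lemma nonneg_if_deriv_nonneg_where_negative:
  fixes f :: "real \<Rightarrow> real"
  assumes "t0 \<le> T" "0 \<le> f t0"
    and deriv: "\<And>t. t \<in> {t0..T} \<Longrightarrow>
      \<exists>D. (f has_real_derivative D) (at t within {t0..T}) \<and> (f t < 0 \<longrightarrow> 0 \<le> D)"
  shows "0 \<le> f T"
proof (rule ccontr)
  assume neg: "\<not> 0 \<le> f T"
  have cont: "continuous_on {t0..T} f"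
    by (rule DERIV_continuous_on[of _ _ "\<lambda>t. SOME D. (f has_real_derivative D) (at t within {t0..T})"])
      (meson someI_ex deriv)
  define S where "S = {t \<in> {t0..T}. 0 \<le> f t}"
  have "S = {t0..T} \<inter> f -` {0..}"
    by (auto simp: S_def)
  then have "closed S"
    using continuous_closed_preimage[OF cont closed_atLeastAtMost closed_atLeast] by simp
  moreover have "bounded S"
    by (rule bounded_subset[OF bounded_closed_interval[of t0 T]]) (auto simp: S_def)
  ultimately have "compact S"
    by (simp add: compact_eq_bounded_closed)
  moreover have "t0 \<in> S"
    using assms by (auto simp: S_def)
  ultimately obtain s where s: "s \<in> S" "\<And>t. t \<in> S \<Longrightarrow> t \<le> s"
    using compact_attains_sup[of S] by blast
  have "f s \<le> f T"
  proof (rule nondecreasing_if_deriv_within_nonneg[OF _ _ cont])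
    show "s \<le> T" "t0 \<le> s"
      using s by (auto simp: S_def)
    fix t assume t: "s < t" "t < T"
    then have t': "t \<in> {t0..T}"
      using s(1) by (auto simp: S_def)
    moreover have "t \<notin> S"
      using s(2) t(1) by force
    ultimately have "f t < 0"
      by (auto simp: S_def)
    then show "\<exists>D\<ge>0. (f has_real_derivative D) (at t within {t0..T})"
      using deriv[OF t'] by blast
  qed
  then show False
    using s(1) neg by (auto simp: S_def)
qed

section \<open>Global solvability for a Lipschitz right-hand side\<close>

text \<open>The Picard iterates converge on the whole interval at once, because their successive
  differences are measured against the weight \<open>exp (2 L (t - t0))\<close>: integrating \<open>L\<close> times this
  weight gains a factor \<open>1/2\<close>.\<close>

lemma lipschitz_ivp_solution_exists:
  fixes f :: "real \<Rightarrow> 'a::banach \<Rightarrow> 'a"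
  assumes f: "continuous_on ({t0..T} \<times> UNIV) (\<lambda>(t, x). f t x)"
    and lipschitz: "\<And>t x y. t \<in> {t0..T} \<Longrightarrow> norm (f t x - f t y) \<le> L * norm (x - y)"
  shows "\<exists>y. y t0 = y0 \<and> (\<forall>t\<in>{t0..T}. (y has_vector_derivative f t (y t)) (at t within {t0..T}))"
proof -
  \<comment> \<open>\<open>L\<close> may be zero, but a weight that gains a factor \<open>1/2\<close> has to grow.\<close>
  define K where "K = max L 1"
  have K: "norm (f t x - f t y) \<le> K * norm (x - y)" if "t \<in> {t0..T}" for t x y
    using lipschitz[OF that, of x y] mult_right_mono[of L K "norm (x - y)"]
    by (auto simp: K_def)
  have K0: "K > 0" by (simp add: K_def)
  define step where "step p t = y0 + integral {t0..t} (\<lambda>s. f s (p s))" for p :: "real \<Rightarrow> 'a" and t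
  define p where "p n = (step ^^ n) (\<lambda>_. y0)" for n
  have p_0: "p 0 = (\<lambda>_. y0)" and p_Suc: "p (Suc n) = step (p n)" for n
    by (simp_all add: p_def)
  have cont_f: "continuous_on {t0..T} (\<lambda>s. f s (q s))" if "continuous_on {t0..T} q" for q
  proof -
    have "continuous_on {t0..T} (\<lambda>s. (s, q s))"
      using that by (intro continuous_intros)
    from continuous_on_compose2[OF f this] show ?thesis by auto
  qed
  have cont_step: "continuous_on {t0..T} (step q)" if "continuous_on {t0..T} q" for q
    unfolding step_def
    by (intro continuous_intros indefinite_integral_continuous_1 integrable_continuous_real cont_f that)
  have cont_p: "continuous_on {t0..T} (p n)" for n
    by (induction n) (simp_all add: p_0 p_Suc cont_step)
  have integrable: "(\<lambda>s. f s (q s)) integrable_on {t0..t}"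
    if "continuous_on {t0..T} q" "t \<in> {t0..T}" for q t
    by (rule integrable_continuous_real, rule continuous_on_subset[OF cont_f[OF that(1)]])
      (use that in auto)
  have "bounded ((\<lambda>t. p 1 t - p 0 t) ` {t0..T})"
    by (intro compact_imp_bounded compact_continuous_image continuous_intros cont_p) auto
  then obtain M where M: "\<And>t. t \<in> {t0..T} \<Longrightarrow> norm (p 1 t - p 0 t) \<le> M"
    unfolding bounded_iff by blast
  define W where "W t = exp (2 * K * (t - t0))" for t
  have W_integral: "((\<lambda>s. 2 * K * W s) has_integral W t - W t0) {t0..t}" if "t0 \<le> t" for t
    unfolding W_def
    by (rule fundamental_theorem_of_calculus[OF that])
      (auto intro!: derivative_eq_intros simp: has_real_derivative_iff_has_vector_derivative[symmetric])
  have diff: "norm (p (Suc n) t - p n t) \<le> M / 2 ^ n * W t" if "t \<in> {t0..T}" for n t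
    using that
  proof (induction n arbitrary: t)
    case 0
    have "1 \<le> W t"
      using 0 K0 by (simp add: W_def)
    moreover have "0 \<le> M"
      using M[OF 0] norm_ge_zero order_trans by blast
    ultimately have "M \<le> M * W t"
      by (simp add: mult_le_cancel_left1)
    with M[OF 0] show ?case by simp
  next
    case (Suc n)
    have M0: "0 \<le> M"
      using M[OF Suc.prems] norm_ge_zero order_trans by blast
    have "p (Suc (Suc n)) t - p (Suc n) t =
        integral {t0..t} (\<lambda>s. f s (p (Suc n) s)) - integral {t0..t} (\<lambda>s. f s (p n s))"
      by (simp only: p_Suc[of "Suc n"] p_Suc[of n] step_def[of _ t]) simp
    also have "\<dots> = integral {t0..t} (\<lambda>s. f s (p (Suc n) s) - f s (p n s))"
      by (intro integral_diff[symmetric] integrable cont_p Suc.prems)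
    also have "norm \<dots> \<le> integral {t0..t} (\<lambda>s. M / 2 ^ Suc n * (2 * K * W s))"
    proof (rule integral_norm_bound_integral)
      show "(\<lambda>s. f s (p (Suc n) s) - f s (p n s)) integrable_on {t0..t}"
        by (intro integrable_diff integrable cont_p Suc.prems)
      show "(\<lambda>s. M / 2 ^ Suc n * (2 * K * W s)) integrable_on {t0..t}"
        by (rule integrable_on_mult_right, rule has_integral_integrable, rule W_integral)
          (use Suc.prems in auto)
      fix s assume "s \<in> {t0..t}"
      then have s: "s \<in> {t0..T}" using Suc.prems by auto
      have "norm (f s (p (Suc n) s) - f s (p n s)) \<le> K * norm (p (Suc n) s - p n s)"
        by (rule K[OF s])
      also have "\<dots> \<le> K * (M / 2 ^ n * W s)"
        using Suc.IH[OF s] K0 by (intro mult_left_mono) auto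
      finally show "norm (f s (p (Suc n) s) - f s (p n s)) \<le> M / 2 ^ Suc n * (2 * K * W s)"
        by (simp add: field_simps)
    qed
    also have "\<dots> = M / 2 ^ Suc n * (W t - W t0)"
      using W_integral Suc.prems
      by (intro integral_unique has_integral_mult_right) auto
    also have "\<dots> \<le> M / 2 ^ Suc n * W t"
      using M0 by (intro mult_left_mono) (auto simp: W_def)
    finally show ?case .
  qed
  define y where "y t = y0 + (\<Sum>n. p (Suc n) t - p n t)" for t
  have "uniform_limit {t0..T} (\<lambda>n t. \<Sum>i<n. p (Suc i) t - p i t)
      (\<lambda>t. \<Sum>n. p (Suc n) t - p n t) sequentially"
  proof (rule Weierstrass_m_test)
    fix n t assume t: "t \<in> {t0..T}"
    have M0: "0 \<le> M"
      using M[OF t] norm_ge_zero order_trans by blast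
    have "W t \<le> W T"
      using t K0 by (simp add: W_def)
    then have "M / 2 ^ n * W t \<le> M * W T * (1 / 2) ^ n"
      using M0 by (simp add: power_one_over field_simps mult_left_mono)
    with diff[OF t, of n] show "norm (p (Suc n) t - p n t) \<le> M * W T * (1 / 2) ^ n"
      by linarith
  next
    show "summable (\<lambda>n. M * W T * (1 / 2) ^ n)"
      by (intro summable_mult summable_geometric) auto
  qed
  then have "uniform_limit {t0..T} (\<lambda>n t. y0 + (\<Sum>i<n. p (Suc i) t - p i t)) y sequentially"
    unfolding y_def by (intro uniform_limit_intros)
  moreover have "y0 + (\<Sum>i<n. p (Suc i) t - p i t) = p n t" for n t
    using sum_lessThan_telescope[of "\<lambda>i. p i t" n] by (simp add: p_0)
  ultimately have lim: "uniform_limit {t0..T} p y sequentially"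
    by simp
  have cont_y: "continuous_on {t0..T} y"
    using uniform_limit_theorem[OF _ lim] cont_p by simp
  have lim_f: "uniform_limit {t0..T} (\<lambda>n t. f t (p n t)) (\<lambda>t. f t (y t)) sequentially"
  proof (rule uniform_limitI)
    fix e :: real assume "e > 0"
    then have "\<forall>\<^sub>F n in sequentially. \<forall>t\<in>{t0..T}. dist (p n t) (y t) < e / K"
      using K0 by (intro uniform_limitD[OF lim]) auto
    then show "\<forall>\<^sub>F n in sequentially. \<forall>t\<in>{t0..T}. dist (f t (p n t)) (f t (y t)) < e"
    proof eventually_elim
      case (elim n)
      show ?case
      proof
        fix t assume t: "t \<in> {t0..T}"
        have "norm (f t (p n t) - f t (y t)) \<le> K * norm (p n t - y t)"
          by (rule K[OF t])
        also have "\<dots> < e"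
          using elim t K0 by (simp add: dist_norm pos_less_divide_eq mult.commute)
        finally show "dist (f t (p n t)) (f t (y t)) < e"
          by (simp add: dist_norm)
      qed
    qed
  qed
  have fixed: "y t = step y t" if t: "t \<in> {t0..T}" for t
  proof (rule LIMSEQ_unique)
    show "(\<lambda>n. p (Suc n) t) \<longlonglongrightarrow> y t"
      by (intro LIMSEQ_Suc tendsto_uniform_limitI[OF lim t])
    have sub: "{t0..t} \<subseteq> {t0..T}" using t by auto
    obtain I J where IJ: "\<And>n. ((\<lambda>s. f s (p n s)) has_integral I n) {t0..t}"
        "((\<lambda>s. f s (y s)) has_integral J) {t0..t}" "I \<longlonglongrightarrow> J"
      using uniform_limit_integral[OF uniform_limit_on_subset[OF lim_f sub]
          continuous_on_subset[OF cont_f[OF cont_p] sub]] by auto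
    have "(\<lambda>n. y0 + I n) \<longlonglongrightarrow> y0 + J"
      by (intro tendsto_intros IJ)
    then show "(\<lambda>n. p (Suc n) t) \<longlonglongrightarrow> step y t"
      by (simp add: p_Suc step_def IJ(1)[THEN integral_unique] IJ(2)[THEN integral_unique])
  qed
  have "(step y has_vector_derivative f t (y t)) (at t within {t0..T})" if t: "t \<in> {t0..T}" for t
    unfolding step_def
    using integral_has_vector_derivative[OF cont_f[OF cont_y] t]
    by (auto intro!: derivative_eq_intros)
  then have "(step y has_vector_derivative f t (step y t)) (at t within {t0..T})"
    if "t \<in> {t0..T}" for t
    using fixed that by metis
  moreover have "step y t0 = y0"
    by (simp add: step_def)
  ultimately show ?thesis by blast
qed

section \<open>Comparison of Abel equations\<close>

lemma abel_solution_subset: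
  "abel_solution a b c d I y \<Longrightarrow> J \<subseteq> I \<Longrightarrow> abel_solution a b c d J y"
  unfolding abel_solution_def by (meson DERIV_subset subsetD)

lemma abel_solution_continuous_on:
  "abel_solution a b c d I y \<Longrightarrow> continuous_on I y"
  unfolding abel_solution_def continuous_on_eq_continuous_within
  by (meson DERIV_continuous)

text \<open>The sign conditions say that \<open>y1\<close> is a subsolution and \<open>y2\<close> a supersolution of the equation
  with coefficients \<open>a, b, c, d\<close>. As \<open>p - q\<close> divides the difference of the values of a cubic at
  \<open>p\<close> and \<open>q\<close>, the difference \<open>y2 - y1\<close> satisfies a homogeneous linear differential inequality.
  The bound gives the weak comparison, by \<open>k > 0\<close> the strict one, and, for two solutions taken
  in both orders, uniqueness.\<close>

lemma abel_comparison:
  fixes y1 y2 :: "real \<Rightarrow> real"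
  assumes "t0 \<le> T"
    and cont: "continuous_on {t0..T} a" "continuous_on {t0..T} b" "continuous_on {t0..T} c"
    and y1: "abel_solution a1 b1 c1 d1 {t0..T} y1"
    and y2: "abel_solution a2 b2 c2 d2 {t0..T} y2"
    and sub: "\<And>t. t \<in> {t0..T} \<Longrightarrow> (a1 t - a t) * y1 t ^ 3 + (b1 t - b t) * y1 t ^ 2
           + (c1 t - c t) * y1 t + d1 t - d t \<ge> 0"
    and super: "\<And>t. t \<in> {t0..T} \<Longrightarrow> (a2 t - a t) * y2 t ^ 3 + (b2 t - b t) * y2 t ^ 2
           + (c2 t - c t) * y2 t + d2 t - d t \<le> 0"
  shows "\<exists>k>0. y2 T - y1 T \<ge> k * (y2 t0 - y1 t0)"
proof -
  \<comment> \<open>The difference quotient of the cubic \<open>a y^3 + b y^2 + c y + d\<close> between \<open>y1 t\<close> and \<open>y2 t\<close>.\<close>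
  define g where "g t = a t * (y2 t ^ 2 + y2 t * y1 t + y1 t ^ 2) + b t * (y2 t + y1 t) + c t" for t
  have "continuous_on {t0..T} g"
    unfolding g_def
    by (intro continuous_intros cont abel_solution_continuous_on[OF y1] abel_solution_continuous_on[OF y2])
  then have "y2 T - y1 T \<ge> exp (- integral {t0..T} g) * (y2 t0 - y1 t0)"
  proof (rule linear_differential_inequality[OF \<open>t0 \<le> T\<close>])
    fix t assume t: "t \<in> {t0..T}"
    obtain D1 where D1: "(y1 has_real_derivative D1) (at t within {t0..T})"
        "D1 + a1 t * y1 t ^ 3 + b1 t * y1 t ^ 2 + c1 t * y1 t + d1 t = 0"
      using y1 t unfolding abel_solution_def by blast
    obtain D2 where D2: "(y2 has_real_derivative D2) (at t within {t0..T})"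
        "D2 + a2 t * y2 t ^ 3 + b2 t * y2 t ^ 2 + c2 t * y2 t + d2 t = 0"
      using y2 t unfolding abel_solution_def by blast
    have "D2 - D1 + g t * (y2 t - y1 t) =
        (D2 + a t * y2 t ^ 3 + b t * y2 t ^ 2 + c t * y2 t + d t)
        - (D1 + a t * y1 t ^ 3 + b t * y1 t ^ 2 + c t * y1 t + d t)"
      by (simp add: g_def algebra_simps power2_eq_square power3_eq_cube)
    also have "\<dots> \<ge> 0"
      using sub[OF t] super[OF t] D1(2) D2(2) by (simp add: algebra_simps)
    finally show "\<exists>D. ((\<lambda>t. y2 t - y1 t) has_real_derivative D) (at t within {t0..T}) \<and>
        0 \<le> D + g t * (y2 t - y1 t)"
      using DERIV_diff[OF D2(1) D1(1)] by blast
  qed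
  then show ?thesis
    by (intro exI[of _ "exp (- integral {t0..T} g)"]) auto
qed

lemma abel_solution_unique:
  assumes "t0 \<le> T"
    and cont: "continuous_on {t0..T} a" "continuous_on {t0..T} b" "continuous_on {t0..T} c"
    and y: "abel_solution a b c d {t0..T} y" and z: "abel_solution a b c d {t0..T} z"
    and "y t0 = z t0"
  shows "y T = z T"
  using abel_comparison[OF \<open>t0 \<le> T\<close> cont y z, of d] abel_comparison[OF \<open>t0 \<le> T\<close> cont z y, of d]
    \<open>y t0 = z t0\<close>
  by auto

text \<open>Clamping the unknown between \<open>y1\<close> and \<open>y2\<close> makes the right-hand side globally Lipschitz.
  A solution of the clamped equation cannot leave the strip: where it lies above \<open>y2\<close>, its
  slope is the right-hand side at \<open>y2\<close>, hence at most the slope of \<open>y2\<close>, and symmetrically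
  below \<open>y1\<close>. So it solves the original equation.\<close>

lemma abel_solution_exists_between:
  fixes y1 y2 :: "real \<Rightarrow> real"
  assumes cont: "continuous_on {t0..T} a" "continuous_on {t0..T} b" "continuous_on {t0..T} c"
      "continuous_on {t0..T} d"
    and y1: "abel_solution a1 b1 c1 d1 {t0..T} y1"
    and y2: "abel_solution a2 b2 c2 d2 {t0..T} y2"
    and sub: "\<And>t. t \<in> {t0..T} \<Longrightarrow> (a1 t - a t) * y1 t ^ 3 + (b1 t - b t) * y1 t ^ 2
           + (c1 t - c t) * y1 t + d1 t - d t \<ge> 0"
    and super: "\<And>t. t \<in> {t0..T} \<Longrightarrow> (a2 t - a t) * y2 t ^ 3 + (b2 t - b t) * y2 t ^ 2
           + (c2 t - c t) * y2 t + d2 t - d t \<le> 0"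
    and le: "\<And>t. t \<in> {t0..T} \<Longrightarrow> y1 t \<le> y2 t"
    and y0: "y0 \<in> {y1 t0..y2 t0}"
  shows "\<exists>y. abel_solution a b c d {t0..T} y \<and> y t0 = y0"
proof -
  define clamp where "clamp t x = min (max x (y1 t)) (y2 t)" for t x
  define F where "F t x = - (a t * x ^ 3 + b t * x ^ 2 + c t * x + d t)" for t x
  define f where "f t x = F t (clamp t x)" for t x
  note cont_y = abel_solution_continuous_on[OF y1] abel_solution_continuous_on[OF y2]
  have fst: "continuous_on ({t0..T} \<times> UNIV) (\<lambda>z::real \<times> real. h (fst z))"
    if "continuous_on {t0..T} h" for h :: "real \<Rightarrow> real"
    by (rule continuous_on_compose2[OF that continuous_on_fst[OF continuous_on_id]]) auto
  have cont_f: "continuous_on ({t0..T} \<times> UNIV) (\<lambda>(t, x). f t x)"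
    unfolding f_def F_def clamp_def case_prod_beta
    by (intro continuous_intros fst cont cont_y)
  have "\<exists>B. \<forall>t\<in>{t0..T}. \<bar>h t\<bar> \<le> B" if "continuous_on {t0..T} h" for h :: "real \<Rightarrow> real"
    using compact_imp_bounded[OF compact_continuous_image[OF that compact_Icc]]
    by (auto simp: bounded_iff)
  from this[OF cont(1)] this[OF cont(2)] this[OF cont(3)] this[OF cont_y(1)] this[OF cont_y(2)]
  obtain A B C Y1 Y2 where bounds: "\<And>t. t \<in> {t0..T} \<Longrightarrow> \<bar>a t\<bar> \<le> A"
      "\<And>t. t \<in> {t0..T} \<Longrightarrow> \<bar>b t\<bar> \<le> B" "\<And>t. t \<in> {t0..T} \<Longrightarrow> \<bar>c t\<bar> \<le> C"
      "\<And>t. t \<in> {t0..T} \<Longrightarrow> \<bar>y1 t\<bar> \<le> Y1" "\<And>t. t \<in> {t0..T} \<Longrightarrow> \<bar>y2 t\<bar> \<le> Y2"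
    by metis
  define Y where "Y = max Y1 Y2"
  have lipschitz: "norm (f t x - f t z) \<le> (A * (3 * Y ^ 2) + B * (2 * Y) + C) * norm (x - z)"
    if t: "t \<in> {t0..T}" for t x z
  proof -
    define X Z where "X = clamp t x" and "Z = clamp t z"
    have XZ: "\<bar>X\<bar> \<le> Y" "\<bar>Z\<bar> \<le> Y" "\<bar>X - Z\<bar> \<le> \<bar>x - z\<bar>"
      using bounds(4,5)[OF t] le[OF t]
      by (auto simp: X_def Z_def clamp_def Y_def min_def max_def abs_if split: if_splits)
    have "f t x - f t z = - ((a t * (X ^ 2 + X * Z + Z ^ 2) + b t * (X + Z) + c t) * (X - Z))"
      by (simp add: f_def F_def X_def[symmetric] Z_def[symmetric] algebra_simps
          power2_eq_square power3_eq_cube)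
    then have "norm (f t x - f t z) = \<bar>a t * (X ^ 2 + X * Z + Z ^ 2) + b t * (X + Z) + c t\<bar> * \<bar>X - Z\<bar>"
      by (simp only: real_norm_def abs_minus_cancel abs_mult)
    also have "\<dots> \<le> (A * (3 * Y ^ 2) + B * (2 * Y) + C) * \<bar>x - z\<bar>"
    proof (intro mult_mono XZ)
      have sq: "X ^ 2 \<le> Y ^ 2" "Z ^ 2 \<le> Y ^ 2"
        using XZ by (auto simp: abs_le_square_iff[symmetric])
      have "\<bar>X * Z\<bar> \<le> Y * Y"
        unfolding abs_mult using XZ by (intro mult_mono) auto
      then have "\<bar>X ^ 2 + X * Z + Z ^ 2\<bar> \<le> 3 * Y ^ 2"
        using sq zero_le_power2[of X] zero_le_power2[of Z] unfolding power2_eq_square[of Y] by linarith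
      then have "\<bar>a t * (X ^ 2 + X * Z + Z ^ 2)\<bar> \<le> A * (3 * Y ^ 2)"
        unfolding abs_mult using bounds(1)[OF t] by (intro mult_mono) auto
      moreover have "\<bar>b t * (X + Z)\<bar> \<le> B * (2 * Y)"
        unfolding abs_mult using bounds(2)[OF t] XZ by (intro mult_mono) auto
      ultimately show "\<bar>a t * (X ^ 2 + X * Z + Z ^ 2) + b t * (X + Z) + c t\<bar>
          \<le> A * (3 * Y ^ 2) + B * (2 * Y) + C"
        using bounds(3)[OF t] by linarith
      then show "0 \<le> A * (3 * Y ^ 2) + B * (2 * Y) + C"
        by linarith
    qed simp
    finally show ?thesis by simp
  qed
  from lipschitz_ivp_solution_exists[OF cont_f lipschitz, of y0]
  obtain y where y: "y t0 = y0"
      "\<And>t. t \<in> {t0..T} \<Longrightarrow> (y has_real_derivative f t (y t)) (at t within {t0..T})"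
    by (auto simp: has_real_derivative_iff_has_vector_derivative)
  have upper: "y t \<le> y2 t" if t: "t \<in> {t0..T}" for t
  proof -
    have "0 \<le> y2 t - y t"
    proof (rule nonneg_if_deriv_nonneg_where_negative[where f = "\<lambda>s. y2 s - y s" and T = t])
      show "t0 \<le> t" "0 \<le> y2 t0 - y t0"
        using t y(1) y0 by auto
      fix s assume s: "s \<in> {t0..t}"
      then have s': "s \<in> {t0..T}" using t by auto
      obtain D where D: "(y2 has_real_derivative D) (at s within {t0..T})"
          "D + a2 s * y2 s ^ 3 + b2 s * y2 s ^ 2 + c2 s * y2 s + d2 s = 0"
        using y2 s' unfolding abel_solution_def by blast
      have "((\<lambda>s. y2 s - y s) has_real_derivative D - f s (y s)) (at s within {t0..t})"
        by (rule DERIV_subset[OF DERIV_diff[OF D(1) y(2)[OF s']]]) (use t in auto)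
      moreover have "0 \<le> D - f s (y s)" if "y2 s - y s < 0"
      proof -
        have "f s (y s) = F s (y2 s)"
          using that le[OF s'] by (simp add: f_def clamp_def)
        then show ?thesis
          using super[OF s'] D(2) by (simp add: F_def algebra_simps)
      qed
      ultimately show "\<exists>D. ((\<lambda>s. y2 s - y s) has_real_derivative D) (at s within {t0..t}) \<and>
          (y2 s - y s < 0 \<longrightarrow> 0 \<le> D)"
        by blast
    qed
    then show ?thesis by simp
  qed
  have lower: "y1 t \<le> y t" if t: "t \<in> {t0..T}" for t
  proof -
    have "0 \<le> y t - y1 t"
    proof (rule nonneg_if_deriv_nonneg_where_negative[where f = "\<lambda>s. y s - y1 s" and T = t])
      show "t0 \<le> t" "0 \<le> y t0 - y1 t0"
        using t y(1) y0 by auto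
      fix s assume s: "s \<in> {t0..t}"
      then have s': "s \<in> {t0..T}" using t by auto
      obtain D where D: "(y1 has_real_derivative D) (at s within {t0..T})"
          "D + a1 s * y1 s ^ 3 + b1 s * y1 s ^ 2 + c1 s * y1 s + d1 s = 0"
        using y1 s' unfolding abel_solution_def by blast
      have "((\<lambda>s. y s - y1 s) has_real_derivative f s (y s) - D) (at s within {t0..t})"
        by (rule DERIV_subset[OF DERIV_diff[OF y(2)[OF s'] D(1)]]) (use t in auto)
      moreover have "0 \<le> f s (y s) - D" if "y s - y1 s < 0"
      proof -
        have "f s (y s) = F s (y1 s)"
          using that le[OF s'] by (simp add: f_def clamp_def)
        then show ?thesis
          using sub[OF s'] D(2) by (simp add: F_def algebra_simps)
      qed
      ultimately show "\<exists>D. ((\<lambda>s. y s - y1 s) has_real_derivative D) (at s within {t0..t}) \<and>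
          (y s - y1 s < 0 \<longrightarrow> 0 \<le> D)"
        by blast
    qed
    then show ?thesis by simp
  qed
  have "f t (y t) = F t (y t)" if "t \<in> {t0..T}" for t
    using upper[OF that] lower[OF that] by (simp add: f_def clamp_def)
  then have "abel_solution a b c d {t0..T} y"
    unfolding abel_solution_def using y(2) by (force simp: F_def)
  with y(1) show ?thesis by blast
qed

section \<open>Half-open intervals\<close>

lemma Icc_subset_halfopen: "t \<in> halfopen t0 \<tau>0 \<Longrightarrow> {t0..t} \<subseteq> halfopen t0 \<tau>0"
  using le_less_trans[of "ereal _" "ereal t" \<tau>0] by (auto simp: halfopen_def)

lemma halfopen_no_last:
  assumes "t \<in> halfopen t0 \<tau>0"
  shows "\<exists>T\<in>halfopen t0 \<tau>0. t < T"
proof -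
  from assms obtain T where "ereal t < ereal T" "ereal T < \<tau>0"
    using ereal_dense2[of "ereal t" \<tau>0] unfolding halfopen_def by blast
  with assms show ?thesis by (intro bexI[of _ T]) (auto simp: halfopen_def)
qed

text \<open>By uniqueness the solutions on \<open>{t0..T}\<close> for the various \<open>T\<close> agree on their common domain,
  so the value at \<open>t\<close> of the one that ends at \<open>t\<close> defines a solution on the union.\<close>

lemma abel_ivp_exists_on_halfopen:
  assumes t0: "ereal t0 < \<tau>0"
    and cont: "continuous_on (halfopen t0 \<tau>0) a" "continuous_on (halfopen t0 \<tau>0) b"
      "continuous_on (halfopen t0 \<tau>0) c"
    and ex: "\<And>T. T \<in> halfopen t0 \<tau>0 \<Longrightarrow> \<exists>y. abel_solution a b c d {t0..T} y \<and> y t0 = y0"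
  shows "abel_ivp_exists_on a b c d t0 y0 (halfopen t0 \<tau>0)"
proof -
  let ?I = "halfopen t0 \<tau>0"
  obtain Y where Y: "\<And>T. T \<in> ?I \<Longrightarrow> abel_solution a b c d {t0..T} (Y T)"
      "\<And>T. T \<in> ?I \<Longrightarrow> Y T t0 = y0"
    using ex by metis
  define y where "y t = Y t t" for t
  have t0_in: "t0 \<in> ?I" using t0 by (simp add: halfopen_def)
  have unique: "z t = y t"
    if "t \<in> ?I" "abel_solution a b c d J z" "{t0..t} \<subseteq> J" "z t0 = y0" for z t J
    unfolding y_def
  proof (rule abel_solution_unique[where T = t and y = z and z = "Y t"])
    show "t0 \<le> t" using that by (simp add: halfopen_def)
    show "continuous_on {t0..t} a" "continuous_on {t0..t} b" "continuous_on {t0..t} c"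
      using cont continuous_on_subset Icc_subset_halfopen[OF that(1)] by blast+
    show "abel_solution a b c d {t0..t} z"
      using that abel_solution_subset by blast
    show "abel_solution a b c d {t0..t} (Y t)" "z t0 = Y t t0"
      using Y[OF that(1)] that(4) by auto
  qed
  have "abel_solution a b c d ?I y"
    unfolding abel_solution_def
  proof
    fix t assume t: "t \<in> ?I"
    obtain T where T: "T \<in> ?I" "t < T"
      using halfopen_no_last[OF t] by blast
    have agree: "Y T s = y s" if "s \<in> {t0..T}" for s
      by (rule unique[OF _ Y(1)[OF T(1)] _ Y(2)[OF T(1)]])
        (use that Icc_subset_halfopen[OF T(1)] in auto)
    have "t \<in> {t0..T}" using t T by (auto simp: halfopen_def)
    then obtain D where D: "(Y T has_real_derivative D) (at t within {t0..T})"
        "D + a t * y t ^ 3 + b t * y t ^ 2 + c t * y t + d t = 0"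
      using Y(1)[OF T(1)] agree by (fastforce simp: abel_solution_def)
    have "(y has_real_derivative D) (at t within {t0..T})"
      by (rule has_field_derivative_transform_within[OF D(1) zero_less_one \<open>t \<in> {t0..T}\<close> agree])
    moreover have "at t within ?I = at t within {t0..T}"
      by (rule at_within_nhd[where S = "{..<T}"])
        (use T Icc_subset_halfopen[OF T(1)] in \<open>auto simp: halfopen_def\<close>)
    ultimately show "\<exists>D. (y has_real_derivative D) (at t within ?I) \<and>
        D + a t * y t ^ 3 + b t * y t ^ 2 + c t * y t + d t = 0"
      using D(2) by auto
  qed
  moreover have "y t0 = y0"
    unfolding y_def by (rule Y(2)[OF t0_in])
  moreover have "z t = y t"
    if "is_interval J" "t0 \<in> J" "J \<subseteq> ?I" "abel_solution a b c d J z" "z t0 = y0" "t \<in> J" for J z t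
  proof (rule unique[OF _ that(4) _ that(5)])
    show "t \<in> ?I" using that by blast
    show "{t0..t} \<subseteq> J"
      using that by (meson atLeastAtMost_iff mem_is_interval_1_I subsetI)
  qed
  ultimately show ?thesis
    unfolding abel_ivp_exists_on_def by blast
qed

section \<open>The comparison theorem\<close>

theorem theorem3p5:
  fixes t0 :: real and \<tau>0 :: ereal
    and a b c d a1 b1 c1 d1 a2 b2 c2 d2 y1 y2 :: "real \<Rightarrow> real"
  assumes "ereal t0 < \<tau>0"
    and "continuous_on (halfopen t0 \<tau>0) a" and "continuous_on (halfopen t0 \<tau>0) b"
    and "continuous_on (halfopen t0 \<tau>0) c" and "continuous_on (halfopen t0 \<tau>0) d"
    and "continuous_on (halfopen t0 \<tau>0) a1" and "continuous_on (halfopen t0 \<tau>0) b1"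
    and "continuous_on (halfopen t0 \<tau>0) c1" and "continuous_on (halfopen t0 \<tau>0) d1"
    and "continuous_on (halfopen t0 \<tau>0) a2" and "continuous_on (halfopen t0 \<tau>0) b2"
    and "continuous_on (halfopen t0 \<tau>0) c2" and "continuous_on (halfopen t0 \<tau>0) d2"
    and "abel_solution a1 b1 c1 d1 (halfopen t0 \<tau>0) y1"
    and "abel_solution a2 b2 c2 d2 (halfopen t0 \<tau>0) y2"
    and "y1 t0 \<le> y2 t0"
    and "\<forall>t\<in>halfopen t0 \<tau>0. (a1 t - a t) * y1 t ^ 3 + (b1 t - b t) * y1 t ^ 2
           + (c1 t - c t) * y1 t + d1 t - d t \<ge> 0"
    and "\<forall>t\<in>halfopen t0 \<tau>0. (a2 t - a t) * y2 t ^ 3 + (b2 t - b t) * y2 t ^ 2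
           + (c2 t - c t) * y2 t + d2 t - d t \<le> 0"
  shows "(\<forall>y0\<in>{y1 t0..y2 t0}. abel_ivp_exists_on a b c d t0 y0 (halfopen t0 \<tau>0)) \<and>
    (\<forall>y. abel_solution a b c d (halfopen t0 \<tau>0) y \<and> y t0 \<in> {y1 t0..y2 t0} \<longrightarrow>
       (\<forall>t\<in>halfopen t0 \<tau>0. y1 t \<le> y t \<and> y t \<le> y2 t) \<and>
       (y1 t0 < y t0 \<longrightarrow> (\<forall>t\<in>halfopen t0 \<tau>0. y1 t < y t)) \<and>
       (y t0 < y2 t0 \<longrightarrow> (\<forall>t\<in>halfopen t0 \<tau>0. y t < y2 t)))"
proof -
  let ?I = "halfopen t0 \<tau>0"
  note y1 = assms(14) and y2 = assms(15)
  have sub: "\<And>t. t \<in> ?I \<Longrightarrow> (a1 t - a t) * y1 t ^ 3 + (b1 t - b t) * y1 t ^ 2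
           + (c1 t - c t) * y1 t + d1 t - d t \<ge> 0"
    and super: "\<And>t. t \<in> ?I \<Longrightarrow> (a2 t - a t) * y2 t ^ 3 + (b2 t - b t) * y2 t ^ 2
           + (c2 t - c t) * y2 t + d2 t - d t \<le> 0"
    using assms(17,18) by blast+
  have cont: "continuous_on {t0..t} a" "continuous_on {t0..t} b" "continuous_on {t0..t} c"
      "continuous_on {t0..t} d" if "t \<in> ?I" for t
    using assms(2-5) continuous_on_subset Icc_subset_halfopen[OF that] by blast+
  have ge: "t0 \<le> t" if "t \<in> ?I" for t
    using that by (simp add: halfopen_def)
  have in_I: "s \<in> ?I" if "t \<in> ?I" "s \<in> {t0..t}" for s t
    using that Icc_subset_halfopen by blast
  have restrict: "abel_solution \<alpha> \<beta> \<gamma> \<delta> {t0..t} z"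
    if "abel_solution \<alpha> \<beta> \<gamma> \<delta> ?I z" "t \<in> ?I" for \<alpha> \<beta> \<gamma> \<delta> z t
    using that abel_solution_subset Icc_subset_halfopen by blast
  have le: "y1 t \<le> y2 t" if t: "t \<in> ?I" for t
  proof -
    obtain k where "k > 0" "y2 t - y1 t \<ge> k * (y2 t0 - y1 t0)"
      using abel_comparison[OF ge[OF t] cont(1-3)[OF t] restrict[OF y1 t] restrict[OF y2 t]
          sub[OF in_I[OF t]] super[OF in_I[OF t]]] by blast
    moreover have "k * (y2 t0 - y1 t0) \<ge> 0"
      using \<open>k > 0\<close> assms(16) by simp
    ultimately show ?thesis by linarith
  qed
  have "abel_ivp_exists_on a b c d t0 y0 ?I" if y0: "y0 \<in> {y1 t0..y2 t0}" for y0
  proof (rule abel_ivp_exists_on_halfopen[OF assms(1-4)])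
    fix T assume T: "T \<in> ?I"
    show "\<exists>y. abel_solution a b c d {t0..T} y \<and> y t0 = y0"
      by (rule abel_solution_exists_between[OF cont[OF T] restrict[OF y1 T] restrict[OF y2 T]
          sub[OF in_I[OF T]] super[OF in_I[OF T]] le[OF in_I[OF T]] y0])
  qed
  moreover have "(y1 t \<le> y t \<and> y t \<le> y2 t) \<and> (y1 t0 < y t0 \<longrightarrow> y1 t < y t) \<and>
      (y t0 < y2 t0 \<longrightarrow> y t < y2 t)"
    if y: "abel_solution a b c d ?I y" and y0: "y t0 \<in> {y1 t0..y2 t0}" and t: "t \<in> ?I" for y t
  proof -
    \<comment> \<open>\<open>y\<close> serves as supersolution against \<open>y1\<close> and as subsolution against \<open>y2\<close>.\<close>
    obtain k where k: "k > 0" "y t - y1 t \<ge> k * (y t0 - y1 t0)"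
      using abel_comparison[OF ge[OF t] cont(1-3)[OF t] restrict[OF y1 t] restrict[OF y t]
          sub[OF in_I[OF t]]] by auto
    obtain l where l: "l > 0" "y2 t - y t \<ge> l * (y2 t0 - y t0)"
      using abel_comparison[OF ge[OF t] cont(1-3)[OF t] restrict[OF y t] restrict[OF y2 t] _
          super[OF in_I[OF t]]] by auto
    have "k * (y t0 - y1 t0) \<ge> 0" "l * (y2 t0 - y t0) \<ge> 0"
      using k l y0 by auto
    moreover have "y1 t0 < y t0 \<Longrightarrow> k * (y t0 - y1 t0) > 0" "y t0 < y2 t0 \<Longrightarrow> l * (y2 t0 - y t0) > 0"
      using k l by auto
    ultimately show ?thesis
      using k(2) l(2) by fastforce
  qed
  ultimately show ?thesis by blast
qed

end
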